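(* (Quantum Coupling Inequality) Let $\varphi$ and $\psi$ be normal states on a von Neumann algebra $\mathcal M$ (given in standard representation on $L^2(\mathcal M)$ with modular conjugation $J$ and commutant $\mathcal M'$). Let $\hat\varphi$ be a coupling of $\varphi$ and the opposite state $\psi'$, and let $p_\Delta \in \mathcal M \otimes \mathcal M'$ be a diagonal projection. Then $$\|\varphi - \psi\| \le 4\,\bigl(1 - \hat\varphi(p_\Delta)\bigr)^{1/2}.$$
   Context: $\mathcal M$ acts in standard representation on its standard Hilbert space $L^2(\mathcal M)$ with modular conjugation $J$, so the commutant is $\mathcal M' = J\mathcal M J$. $\mathcal M \otimes \mathcal M'$ is the von Neumann tensor product. For a normal state $\psi$ on $\mathcal M$, $\xi_\psi \in L^2(\mathcal M)$ is its standard GNS vector (the representing vector in the natural positive cone), and the opposite state $\psi'$ on $\mathcal M'$ is $\psi'(x') = \langle x'\xi_\psi, \xi_\psi\rangle$. Scalar products are linear in the first component. A coupling of normal states $\varphi$ on $\mathcal M$ and $\omega$ on a von Neumann algebra $\mathcal N$ is a normal state $\hat\varphi$ on $\mathcal M \otimes \mathcal N$ with $\hat\varphi(x\otimes 1) = \varphi(x)$ and $\hat\varphi(1 \otimes y) = \omega(y)$ for all $x\in\mathcal M$, $y \in \mathcal N$. A projection $p_\Delta \in \mathcal M\otimes\mathcal M'$ is called a diagonal projection if $p_\Delta (x\otimes 1) p_\Delta = p_\Delta (1 \otimes Jx^*J) p_\Delta$ for every $x \in \mathcal M$. *)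

theory Defs
  imports "HOL-Analysis.Analysis" "HOL-Library.Complex_Order"
begin

section \<open>Complex Hilbert spaces\<close>

text \<open>
  A complex Hilbert space is a complete real inner product space with a compatible complex
  scalar multiplication and an inner product \<open>cinner\<close>, linear in the first component,
  whose real part is the real inner product. The norm, the topology and the type of bounded
  operators are then those of the library.
\<close>

class scaleC =
  fixes scaleC :: "complex \<Rightarrow> 'a \<Rightarrow> 'a"  (infixr \<open>*\<^sub>C\<close> 75)

class complex_hilbert_space = real_inner + complete_space + scaleC +
  fixes cinner :: "'a \<Rightarrow> 'a \<Rightarrow> complex"
  assumes scaleC_add_right: "c *\<^sub>C (u + v) = c *\<^sub>C u + c *\<^sub>C v"
    and scaleC_add_left: "(c + d) *\<^sub>C u = c *\<^sub>C u + d *\<^sub>C u"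
    and scaleC_scaleC: "c *\<^sub>C d *\<^sub>C u = (c * d) *\<^sub>C u"
    and scaleR_scaleC: "r *\<^sub>R u = complex_of_real r *\<^sub>C u"
    and cinner_add_left: "cinner (u + v) w = cinner u w + cinner v w"
    and cinner_scaleC_left: "cinner (c *\<^sub>C u) v = c * cinner u v"
    and cinner_commute: "cinner u v = cnj (cinner v u)"
    and inner_eq_Re_cinner: "u \<bullet> v = Re (cinner u v)"

instantiation complex :: complex_hilbert_space
begin

definition scaleC_complex :: "complex \<Rightarrow> complex \<Rightarrow> complex"
  where "scaleC_complex c z = c * z"

definition cinner_complex :: "complex \<Rightarrow> complex \<Rightarrow> complex"
  where "cinner_complex z w = z * cnj w"

instance
  by standard
    (auto simp: scaleC_complex_def cinner_complex_def inner_complex_def algebra_simps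
      scaleR_conv_of_real)

end

lemma cinner_scaleC_right:
  fixes u v :: "'a::complex_hilbert_space"
  shows "cinner u (c *\<^sub>C v) = cnj c * cinner u v"
  by (metis cinner_commute cinner_scaleC_left complex_cnj_mult)

lemma cinner_self:
  fixes u :: "'a::complex_hilbert_space"
  shows "cinner u u = complex_of_real ((norm u)\<^sup>2)"
proof -
  have "Im (cinner u u) = 0"
    using arg_cong [OF cinner_commute [of u u], of Im] by simp
  then show ?thesis
    by (simp add: complex_eq_iff power2_norm_eq_inner inner_eq_Re_cinner)
qed

lemma norm_scaleC:
  fixes u :: "'a::complex_hilbert_space"
  shows "norm (c *\<^sub>C u) = cmod c * norm u"
proof -
  have "complex_of_real ((norm (c *\<^sub>C u))\<^sup>2) = (c * cnj c) * cinner u u"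
    by (simp only: cinner_self [symmetric] cinner_scaleC_left cinner_scaleC_right mult.assoc
        mult.left_commute)
  also have "\<dots> = complex_of_real ((cmod c * norm u)\<^sup>2)"
    by (simp only: cinner_self complex_norm_square [symmetric] power_mult_distrib of_real_mult)
  finally show ?thesis
    by (simp add: of_real_eq_iff power2_eq_iff_nonneg del: of_real_power)
qed

lemma bounded_linear_scaleC:
  fixes c :: complex
  shows "bounded_linear (\<lambda>u::'a::complex_hilbert_space. c *\<^sub>C u)"
  by (rule bounded_linear_intro [where K = "cmod c"])
    (simp_all add: scaleC_add_right scaleR_scaleC scaleC_scaleC norm_scaleC mult.commute)


section \<open>Bounded operators\<close>

text \<open>
  The library type of bounded operators is real-linear; \<open>BH\<close> singles out the complex-linear
  ones. The operator norm is the same. Antilinear maps such as the modular conjugation also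
  have this type.
\<close>

type_synonym 'h op = "'h \<Rightarrow>\<^sub>L 'h"

definition BH :: "'h::complex_hilbert_space op set" where
  "BH = {T :: 'h op. \<forall>c v. T (c *\<^sub>C v) = c *\<^sub>C T v}"

definition antilinear_op :: "'h::complex_hilbert_space op \<Rightarrow> bool" where
  "antilinear_op T \<longleftrightarrow> (\<forall>c v. T (c *\<^sub>C v) = cnj c *\<^sub>C T v)"

instantiation blinfun :: (real_normed_vector, complex_hilbert_space) scaleC
begin

lift_definition scaleC_blinfun :: "complex \<Rightarrow> 'a \<Rightarrow>\<^sub>L 'b \<Rightarrow> 'a \<Rightarrow>\<^sub>L 'b"
  is "\<lambda>c T v. c *\<^sub>C T v"
  by (rule bounded_linear_compose [OF bounded_linear_scaleC])

instance ..

end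

definition adj :: "'h::complex_hilbert_space op \<Rightarrow> 'h op" where
  "adj T = (THE S :: 'h op. \<forall>u v. cinner (T u) v = cinner u (S v))"

definition positive_op :: "'h::complex_hilbert_space op \<Rightarrow> bool" where
  "positive_op T \<longleftrightarrow> T \<in> BH \<and> (\<forall>v. 0 \<le> cinner (T v) v)"

definition projection :: "'h::complex_hilbert_space op \<Rightarrow> bool" where
  "projection p \<longleftrightarrow> p \<in> BH \<and> adj p = p \<and> p o\<^sub>L p = p"


section \<open>Von Neumann algebras and normal states\<close>

definition commutant :: "'h::complex_hilbert_space op set \<Rightarrow> 'h op set" where
  "commutant S = {y \<in> BH. \<forall>x\<in>S. x o\<^sub>L y = y o\<^sub>L x}"

definition von_neumann_algebra :: "'h::complex_hilbert_space op set \<Rightarrow> bool" where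
  "von_neumann_algebra M \<longleftrightarrow>
     M \<subseteq> BH \<and> (\<forall>x\<in>M. adj x \<in> M) \<and> commutant (commutant M) = M"

text \<open>Functionals on \<open>M\<close> are functions on all operators, of which only the values on \<open>M\<close> matter.\<close>

definition linear_functional_on ::
  "'h::complex_hilbert_space op set \<Rightarrow> ('h op \<Rightarrow> complex) \<Rightarrow> bool" where
  "linear_functional_on M \<phi> \<longleftrightarrow>
     (\<forall>x\<in>M. \<forall>y\<in>M. \<phi> (x + y) = \<phi> x + \<phi> y) \<and> (\<forall>c. \<forall>x\<in>M. \<phi> (c *\<^sub>C x) = c * \<phi> x)"

definition state_on ::
  "'h::complex_hilbert_space op set \<Rightarrow> ('h op \<Rightarrow> complex) \<Rightarrow> bool" where
  "state_on M \<phi> \<longleftrightarrow>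
     linear_functional_on M \<phi> \<and> (\<forall>x\<in>M. 0 \<le> \<phi> (adj x o\<^sub>L x)) \<and> \<phi> id_blinfun = 1"

definition self_adjoint_part :: "'h::complex_hilbert_space op set \<Rightarrow> 'h op set" where
  "self_adjoint_part M = {x \<in> M. adj x = x}"

definition directed :: "'h::complex_hilbert_space op set \<Rightarrow> bool" where
  "directed D \<longleftrightarrow> D \<noteq> {} \<and>
     (\<forall>x\<in>D. \<forall>y\<in>D. \<exists>z\<in>D. positive_op (z - x) \<and> positive_op (z - y))"

definition is_lub_in ::
  "'h::complex_hilbert_space op set \<Rightarrow> 'h op set \<Rightarrow> 'h op \<Rightarrow> bool" where
  "is_lub_in A D s \<longleftrightarrow> s \<in> A \<and> (\<forall>x\<in>D. positive_op (s - x)) \<and>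
     (\<forall>u\<in>A. (\<forall>x\<in>D. positive_op (u - x)) \<longrightarrow> positive_op (u - s))"

text \<open>
  A state is normal if it preserves suprema of bounded increasing nets of self-adjoint elements.
  States are real on self-adjoint elements, so \<open>Re\<close> discards nothing.
\<close>

definition normal_state ::
  "'h::complex_hilbert_space op set \<Rightarrow> ('h op \<Rightarrow> complex) \<Rightarrow> bool" where
  "normal_state M \<phi> \<longleftrightarrow> state_on M \<phi> \<and>
     (\<forall>D s. D \<subseteq> self_adjoint_part M \<and> directed D \<and> is_lub_in (self_adjoint_part M) D s
        \<longrightarrow> Re (\<phi> s) = (SUP x\<in>D. Re (\<phi> x)))"

definition functional_norm ::
  "'h::complex_hilbert_space op set \<Rightarrow> ('h op \<Rightarrow> complex) \<Rightarrow> real" where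
  "functional_norm M f = (SUP x\<in>{x \<in> M. norm x \<le> 1}. cmod (f x))"


section \<open>Standard representation\<close>

text \<open>
  Haagerup's standard form \<open>(M, H, J, P)\<close>, which determines \<open>H = L\<^sup>2(M)\<close> with its modular
  conjugation \<open>J\<close> and natural positive cone \<open>P\<close> up to unique unitary equivalence.
\<close>

definition standard_form ::
  "'h::complex_hilbert_space op set \<Rightarrow> 'h op \<Rightarrow> 'h set \<Rightarrow> bool" where
  "standard_form M J P \<longleftrightarrow>
     von_neumann_algebra M \<and>
     antilinear_op J \<and> (\<forall>v. norm (J v) = norm v) \<and> J o\<^sub>L J = id_blinfun \<and>
     P = {v. \<forall>w\<in>P. 0 \<le> cinner v w} \<and>
     (\<lambda>x. J o\<^sub>L x o\<^sub>L J) ` M = commutant M \<and>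
     (\<forall>z\<in>M \<inter> commutant M. J o\<^sub>L z o\<^sub>L J = adj z) \<and>
     (\<forall>v\<in>P. J v = v) \<and>
     (\<forall>x\<in>M. \<forall>v\<in>P. (x o\<^sub>L J o\<^sub>L x o\<^sub>L J) v \<in> P)"

definition vector_functional :: "'h::complex_hilbert_space \<Rightarrow> 'h op \<Rightarrow> complex" where
  "vector_functional \<xi> x = cinner (x \<xi>) \<xi>"

definition standard_GNS_vector ::
  "'h::complex_hilbert_space op set \<Rightarrow> 'h set \<Rightarrow> ('h op \<Rightarrow> complex) \<Rightarrow> 'h \<Rightarrow> bool" where
  "standard_GNS_vector M P \<psi> \<xi> \<longleftrightarrow> \<xi> \<in> P \<and> (\<forall>x\<in>M. \<psi> x = vector_functional \<xi> x)"


section \<open>Tensor products\<close>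

text \<open>
  \<open>hilbert_tensor t\<close> states that \<open>'k\<close>, with elementary tensors \<open>t a b\<close>, is the Hilbert space
  tensor product of \<open>'g\<close> and \<open>'h\<close>. The range of \<open>t\<close> is closed under complex scaling, so its
  real span (the library's \<open>span\<close>) is also its complex span.
\<close>

definition hilbert_tensor ::
  "('g::complex_hilbert_space \<Rightarrow> 'h::complex_hilbert_space \<Rightarrow> 'k::complex_hilbert_space)
    \<Rightarrow> bool" where
  "hilbert_tensor t \<longleftrightarrow>
     (\<forall>a a' b. t (a + a') b = t a b + t a' b) \<and>
     (\<forall>a b b'. t a (b + b') = t a b + t a b') \<and>
     (\<forall>c a b. t (c *\<^sub>C a) b = c *\<^sub>C t a b) \<and>
     (\<forall>c a b. t a (c *\<^sub>C b) = c *\<^sub>C t a b) \<and>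
     (\<forall>a b a' b'. cinner (t a b) (t a' b') = cinner a a' * cinner b b') \<and>
     closure (span {t a b |a b. True}) = UNIV"

definition op_tensor ::
  "('g::complex_hilbert_space \<Rightarrow> 'h::complex_hilbert_space \<Rightarrow> 'k::complex_hilbert_space)
    \<Rightarrow> 'g op \<Rightarrow> 'h op \<Rightarrow> 'k op" where
  "op_tensor t x y = (THE z :: 'k op. z \<in> BH \<and> (\<forall>a b. z (t a b) = t (x a) (y b)))"

definition vn_tensor ::
  "('g::complex_hilbert_space \<Rightarrow> 'h::complex_hilbert_space \<Rightarrow> 'k::complex_hilbert_space)
    \<Rightarrow> 'g op set \<Rightarrow> 'h op set \<Rightarrow> 'k op set" where
  "vn_tensor t M N = commutant (commutant {op_tensor t x y |x y. x \<in> M \<and> y \<in> N})"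


section \<open>Couplings and diagonal projections\<close>

definition coupling ::
  "('g::complex_hilbert_space \<Rightarrow> 'h::complex_hilbert_space \<Rightarrow> 'k::complex_hilbert_space)
    \<Rightarrow> 'g op set \<Rightarrow> 'h op set \<Rightarrow> ('g op \<Rightarrow> complex) \<Rightarrow> ('h op \<Rightarrow> complex)
    \<Rightarrow> ('k op \<Rightarrow> complex) \<Rightarrow> bool" where
  "coupling t M N \<phi> \<omega> \<Phi> \<longleftrightarrow>
     normal_state (vn_tensor t M N) \<Phi> \<and>
     (\<forall>x\<in>M. \<Phi> (op_tensor t x id_blinfun) = \<phi> x) \<and>
     (\<forall>y\<in>N. \<Phi> (op_tensor t id_blinfun y) = \<omega> y)"

definition diagonal_projection ::
  "('h::complex_hilbert_space \<Rightarrow> 'h \<Rightarrow> 'k::complex_hilbert_space)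
    \<Rightarrow> 'h op set \<Rightarrow> 'h op \<Rightarrow> 'k op \<Rightarrow> bool" where
  "diagonal_projection t M J p \<longleftrightarrow>
     p \<in> vn_tensor t M (commutant M) \<and> projection p \<and>
     (\<forall>x\<in>M. p o\<^sub>L op_tensor t x id_blinfun o\<^sub>L p =
             p o\<^sub>L op_tensor t id_blinfun (J o\<^sub>L adj x o\<^sub>L J) o\<^sub>L p)"

end

theory Submission
  imports Defs
begin

text \<open>
  Since \<open>J \<xi>\<^sub>\<psi> = \<xi>\<^sub>\<psi>\<close>, the difference \<open>\<phi> x - \<psi> x\<close> is the value of the coupling at
  \<open>A = x \<otimes> 1 - 1 \<otimes> J x\<^sup>* J\<close>, an operator of norm at most \<open>2\<close> with \<open>p A p = 0\<close>. With \<open>q = 1 - p\<close> this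
  gives \<open>A = q A + p A q\<close>, and the Cauchy-Schwarz inequality for the state bounds each summand by
  \<open>\<parallel>A\<parallel>\<close> times the square root of the value of the coupling at \<open>q\<close>.
\<close>

section \<open>Adjoints\<close>

text \<open>\<open>adj\<close> and \<open>op_tensor\<close> are definite descriptions, so nothing
  can be computed with them until the described operators are known to exist. For adjoints this is
  the Riesz theorem, obtained here from completeness by a minimisation. For tensor products the
  obstacle is that a sum of elementary tensors has many representations. Orthogonalising the second
  factors gives an estimate for \<open>x \<otimes> 1\<close> on such sums, and this single estimate
  yields well-definedness, continuity and the bound \<open>norm x\<close> together. That bound is
  sharp enough for the constant: \<open>4\<close> is \<open>2\<close>, the number of summands to be
  estimated, times \<open>2\<close>, the bound for the norm of a difference of two tensors of norm
  at most \<open>1\<close>. A second obstacle is that positivity of a state is postulated on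
  elements \<open>adj x o\<^sub>L x\<close>, while the estimate compares such an element with a
  multiple of the identity in the operator order.\<close>

text \<open>The representing vector minimises \<open>g u = u \<bullet> u - 2 * f u\<close>, which
  for the right \<open>w\<close> is the squared distance from \<open>u\<close> to \<open>w\<close>
  up to a constant. Completing the square bounds \<open>g\<close> from below, the parallelogram law
  makes minimising sequences Cauchy, and the vanishing first variation at the minimum is the
  claim.\<close>

lemma riesz_representation:
  fixes f :: "'a::{real_inner,complete_space} \<Rightarrow> real"
  assumes "bounded_linear f"
  obtains w where "\<And>u. f u = u \<bullet> w"
proof -
  interpret f: bounded_linear f by fact
  define g where "g u = u \<bullet> u - 2 * f u" for u
  obtain K where K: "\<And>u. \<bar>f u\<bar> \<le> norm u * K"
    using f.bounded by (auto simp: real_norm_def)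
  have lower: "- (K\<^sup>2) \<le> g u" for u
  proof -
    have "2 * f u \<le> 2 * (norm u * K)" using K [of u] by simp
    moreover have "0 \<le> (norm u - K)\<^sup>2" by simp
    ultimately show ?thesis
      by (simp add: g_def power2_norm_eq_inner power2_diff algebra_simps)
  qed
  then have bdd: "bdd_below (range g)" by (intro bdd_belowI [of _ "- (K\<^sup>2)"]) auto
  define m where "m = Inf (range g)"
  have m_le: "m \<le> g u" for u
    unfolding m_def using bdd by (simp add: cInf_lower)
  have "\<exists>u. g u < m + 1 / real (Suc n)" for n
    using cInf_lessD [of "range g" "m + 1 / real (Suc n)"] by (auto simp: m_def)
  then obtain u where u: "\<And>n. g (u n) < m + 1 / real (Suc n)" by metis
  have mid: "(norm (v - w))\<^sup>2 \<le> 2 * (g v - m) + 2 * (g w - m)" for v w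
  proof -
    \<comment> \<open>Parallelogram law; the linear part of \<open>g\<close> is unaffected by taking
      midpoints. Near-minimisers are close because their midpoint cannot fall below
      \<open>m\<close>.\<close>
    have "g ((1/2) *\<^sub>R (v + w)) = (g v + g w) / 2 - (norm (v - w))\<^sup>2 / 4"
      by (simp add: g_def power2_norm_eq_inner f.scaleR f.add inner_add inner_diff inner_commute
          algebra_simps field_simps)
    then show ?thesis using m_le [of "(1/2) *\<^sub>R (v + w)"] by argo
  qed
  have "Cauchy u"
  proof (rule metric_CauchyI)
    fix e :: real assume e: "0 < e"
    \<comment> \<open>Beyond \<open>N\<close> both values exceed \<open>m\<close> by less than
      \<open>1 / real N\<close>, so \<open>mid\<close> gives a squared distance below
      \<open>4 / real N\<close>.\<close>
    obtain N where N: "4 / e\<^sup>2 < real N" using reals_Archimedean2 by blast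
    have N0: "0 < real N" using N e by (smt (verit) divide_pos_pos zero_less_power)
    show "\<exists>N. \<forall>m\<ge>N. \<forall>n\<ge>N. dist (u m) (u n) < e"
    proof (intro exI allI impI)
      fix i j assume "N \<le> i" "N \<le> j"
      then have "1 / real (Suc i) \<le> 1 / real N" "1 / real (Suc j) \<le> 1 / real N"
        using N0 by (auto intro!: divide_left_mono)
      then have "(norm (u i - u j))\<^sup>2 < 4 * (1 / real N)"
        using mid [of "u i" "u j"] u [of i] u [of j] by argo
      also have "\<dots> < e\<^sup>2" using N N0 e by (simp add: field_simps)
      finally show "dist (u i) (u j) < e"
        using e by (simp add: dist_norm power_less_imp_less_base)
    qed
  qed
  then obtain w where w: "u \<longlonglongrightarrow> w" using Cauchy_convergent convergent_def by blast
  have "(\<lambda>n. g (u n)) \<longlonglongrightarrow> g w"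
    unfolding g_def by (intro tendsto_intros w f.tendsto)
  moreover have "(\<lambda>n. m + 1 / real (Suc n)) \<longlonglongrightarrow> m + 0"
    using LIMSEQ_inverse_real_of_nat by (intro tendsto_intros) (simp add: inverse_eq_divide)
  ultimately have gw: "g w \<le> m"
    using u by (intro LIMSEQ_le [of "\<lambda>n. g (u n)" _ "\<lambda>n. m + 1 / real (Suc n)"]) (auto intro: less_imp_le)
  have "f v = v \<bullet> w" for v
  proof (cases "v = 0")
    case False
    define c where "c = w \<bullet> v - f v"
    \<comment> \<open>The minimiser of \<open>s * s * (v \<bullet> v) + 2 * s * c\<close>, the
      change of \<open>g\<close> from \<open>w\<close> to \<open>w + s *\<^sub>R v\<close>; the
      minimum \<open>s * c\<close> is negative unless \<open>c = 0\<close>.\<close>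
    define s where "s = - c / (v \<bullet> v)"
    have vv: "0 < v \<bullet> v" using False by simp
    have "g w \<le> g (w + s *\<^sub>R v)" using gw m_le by (rule order_trans)
    then have "0 \<le> s * (s * (v \<bullet> v)) + 2 * s * c"
      by (simp add: g_def c_def f.add f.scaleR inner_add inner_commute algebra_simps)
    moreover have "s * (v \<bullet> v) = - c" using vv by (simp add: s_def)
    ultimately have "0 \<le> s * c" by (simp add: algebra_simps)
    then have "c * c \<le> 0" using vv by (simp add: s_def divide_simps)
    then have "c = 0" by (auto simp: mult_le_0_iff)
    then show ?thesis by (simp add: c_def inner_commute)
  qed (simp add: f.zero)
  then show thesis by (rule that)
qed

lemma real_adjoint_exists:
  fixes T :: "'a::{real_inner,complete_space} \<Rightarrow>\<^sub>L 'b::real_inner"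
  obtains S :: "'b \<Rightarrow>\<^sub>L 'a" where "\<And>u v. T u \<bullet> v = u \<bullet> S v"
proof -
  have "\<exists>w. \<forall>u. T u \<bullet> v = u \<bullet> w" for v
    using riesz_representation [of "\<lambda>u. T u \<bullet> v"]
    by (metis bounded_linear_inner_left_comp blinfun.bounded_linear_right)
  then obtain S where S: "\<And>u v. T u \<bullet> v = u \<bullet> S v" by metis
  have eq: "a = b" if "\<And>u. u \<bullet> a = u \<bullet> b" for a b :: 'a
    using that by (metis vector_eq_ldot)
  have "bounded_linear S"
  proof (rule bounded_linear_intro [where K = "norm T"])
    show "S (v + w) = S v + S w" for v w
      by (rule eq) (simp add: S [symmetric] inner_add)
    show "S (r *\<^sub>R v) = r *\<^sub>R S v" for r v
      by (rule eq) (simp add: S [symmetric])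
    show "norm (S v) \<le> norm v * norm T" for v
    proof -
      have "(norm (S v))\<^sup>2 = T (S v) \<bullet> v" by (simp add: S power2_norm_eq_inner)
      also have "\<dots> \<le> norm (T (S v)) * norm v" by (rule norm_cauchy_schwarz)
      also have "\<dots> \<le> norm T * norm (S v) * norm v"
        by (intro mult_right_mono norm_blinfun) simp
      finally have "norm (S v) * norm (S v) \<le> norm (S v) * (norm v * norm T)"
        by (simp add: power2_eq_square mult_ac)
      then show ?thesis
        by (cases "S v = 0") (auto simp: mult_le_cancel_left)
    qed
  qed
  then have "\<And>u v. T u \<bullet> v = u \<bullet> Blinfun S v" by (simp add: S bounded_linear_Blinfun_apply)
  then show thesis by (rule that)
qed

section \<open>Calculus of the complex inner product and of complex-linear operators\<close>

lemma Im_cinner: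
  fixes u v :: "'a::complex_hilbert_space"
  shows "Im (cinner u v) = - ((\<i> *\<^sub>C u) \<bullet> v)"
  by (simp add: inner_eq_Re_cinner cinner_scaleC_left)

lemma cinner_add_right:
  fixes u v w :: "'a::complex_hilbert_space"
  shows "cinner u (v + w) = cinner u v + cinner u w"
  by (metis cinner_commute cinner_add_left complex_cnj_add)

lemma scaleC_minus_one:
  fixes u :: "'a::complex_hilbert_space"
  shows "(- 1) *\<^sub>C u = - u"
  using scaleR_scaleC [of "- 1" u] by simp

lemma scaleC_one: "1 *\<^sub>C u = (u::'a::complex_hilbert_space)"
  using scaleR_scaleC [of 1 u] by simp

lemma scaleC_zero_left: "0 *\<^sub>C u = (0::'a::complex_hilbert_space)"
  using scaleR_scaleC [of 0 u] by simp

lemma scaleC_diff_right: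
  fixes u v :: "'a::complex_hilbert_space"
  shows "c *\<^sub>C (u - v) = c *\<^sub>C u - c *\<^sub>C v"
  using scaleC_add_right [of c "u - v" v] by (simp add: algebra_simps)

lemma scaleC_zero_right [simp]: "c *\<^sub>C (0::'a::complex_hilbert_space) = 0"
  using scaleC_diff_right [of c 0 0] by simp

lemma cinner_minus_left:
  fixes u v :: "'a::complex_hilbert_space"
  shows "cinner (- u) v = - cinner u v"
  by (metis cinner_scaleC_left scaleC_minus_one mult_minus1)

lemma cinner_minus_right:
  fixes u v :: "'a::complex_hilbert_space"
  shows "cinner u (- v) = - cinner u v"
  by (metis cinner_commute cinner_minus_left complex_cnj_minus)

lemma cinner_diff_left:
  fixes u v w :: "'a::complex_hilbert_space"
  shows "cinner (u - v) w = cinner u w - cinner v w"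
  using cinner_add_left [of u "- v" w] by (simp add: cinner_minus_left)

lemma cinner_diff_right:
  fixes u v w :: "'a::complex_hilbert_space"
  shows "cinner u (v - w) = cinner u v - cinner u w"
  using cinner_add_right [of u v "- w"] by (simp add: cinner_minus_right)

lemma cinner_zero_left [simp]: "cinner (0::'a::complex_hilbert_space) u = 0"
  using cinner_diff_left [of 0 0 u] by simp

lemma cinner_zero_right [simp]: "cinner (u::'a::complex_hilbert_space) 0 = 0"
  using cinner_diff_right [of u 0 0] by simp

lemma cinner_sum_left: "cinner (sum f A) (u::'a::complex_hilbert_space) = (\<Sum>i\<in>A. cinner (f i) u)"
  by (induction A rule: infinite_finite_induct) (auto simp: cinner_add_left)

lemma cinner_sum_right: "cinner (u::'a::complex_hilbert_space) (sum f A) = (\<Sum>i\<in>A. cinner u (f i))"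
  by (induction A rule: infinite_finite_induct) (auto simp: cinner_add_right)

lemma cinner_ext:
  fixes v w :: "'a::complex_hilbert_space"
  assumes "\<And>u. cinner u v = cinner u w"
  shows "v = w"
  using assms by (metis inner_eq_Re_cinner vector_eq_ldot)

lemma BH_scaleC: "T \<in> BH \<Longrightarrow> blinfun_apply T (c *\<^sub>C v) = c *\<^sub>C T v"
  by (simp add: BH_def)

lemma scaleC_blinfun_apply: "blinfun_apply (c *\<^sub>C T) v = c *\<^sub>C T v"
  by (simp add: scaleC_blinfun.rep_eq)

lemma BH_plus: "S \<in> BH \<Longrightarrow> T \<in> BH \<Longrightarrow> S + T \<in> BH"
  by (simp add: BH_def blinfun.add_left scaleC_add_right)

lemma BH_scale: "T \<in> BH \<Longrightarrow> c *\<^sub>C T \<in> BH"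
  by (simp add: BH_def scaleC_blinfun_apply scaleC_scaleC mult.commute)

lemma BH_minus: "S \<in> BH \<Longrightarrow> T \<in> BH \<Longrightarrow> S - T \<in> BH"
  by (simp add: BH_def blinfun.diff_left scaleC_diff_right)

lemma BH_compose: "S \<in> BH \<Longrightarrow> T \<in> BH \<Longrightarrow> S o\<^sub>L T \<in> BH"
  by (simp add: BH_def)

lemma BH_id: "id_blinfun \<in> BH"
  by (simp add: BH_def)

section \<open>The adjoint of a complex-linear operator\<close>

lemma adj_eqI:
  assumes "\<And>u v. cinner (blinfun_apply T u) v = cinner u (blinfun_apply S v)"
  shows "adj T = S"
  unfolding adj_def
proof (rule the_equality)
  show "\<forall>u v. cinner (T u) v = cinner u (S v)" using assms by simp
  fix S' :: "'a op"
  assume S': "\<forall>u v. cinner (T u) v = cinner u (S' v)"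
  have "cinner u (S' v) = cinner u (S v)" for u v
    using S' assms [of u v] by (simp only:)
  then show "S' = S" by (rule blinfun_eqI [OF cinner_ext])
qed

text \<open>The real adjoint already serves: real parts of \<open>cinner\<close> are real inner
  products, and imaginary parts reduce to them after replacing \<open>u\<close> by
  \<open>\<i> *\<^sub>C u\<close>, which a complex-linear \<open>T\<close> respects. This is what
  gives the description in \<open>adj\<close> a value.\<close>

lemma cinner_adj_right:
  assumes T: "T \<in> BH"
  shows "cinner (blinfun_apply T u) v = cinner u (blinfun_apply (adj T) v)"
proof -
  obtain S where S: "\<And>u v. blinfun_apply T u \<bullet> v = u \<bullet> blinfun_apply S v"
    using real_adjoint_exists [of T] by metis
  have *: "cinner (T u) v = cinner u (S v)" for u v
  proof (rule complex_eqI)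
    show "Re (cinner (T u) v) = Re (cinner u (S v))"
      using S by (simp only: inner_eq_Re_cinner)
    show "Im (cinner (T u) v) = Im (cinner u (S v))"
      using S [of "\<i> *\<^sub>C u" v] by (simp only: Im_cinner BH_scaleC [OF T])
  qed
  show ?thesis by (simp only: adj_eqI [OF *] *)
qed

lemma cinner_adj_left:
  assumes "T \<in> BH"
  shows "cinner (blinfun_apply (adj T) u) v = cinner u (blinfun_apply T v)"
  using cinner_adj_right [OF assms, of v u] by (subst (1 2) cinner_commute) simp

lemma adj_adj: "T \<in> BH \<Longrightarrow> adj (adj T) = T"
  by (rule adj_eqI) (rule cinner_adj_left)

lemma adj_BH: "T \<in> BH \<Longrightarrow> adj T \<in> BH"
proof -
  assume T: "T \<in> BH"
  have "adj T (c *\<^sub>C v) = c *\<^sub>C adj T v" for c v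
    by (rule cinner_ext) (simp add: cinner_scaleC_right flip: cinner_adj_right [OF T])
  then show ?thesis by (simp add: BH_def)
qed

lemma adj_compose: "S \<in> BH \<Longrightarrow> T \<in> BH \<Longrightarrow> adj (S o\<^sub>L T) = adj T o\<^sub>L adj S"
  by (rule adj_eqI) (simp add: cinner_adj_right)

lemma adj_minus: "S \<in> BH \<Longrightarrow> T \<in> BH \<Longrightarrow> adj (S - T) = adj S - adj T"
  by (rule adj_eqI) (simp add: cinner_adj_right blinfun.diff_left cinner_diff_left cinner_diff_right)

lemma adj_plus: "S \<in> BH \<Longrightarrow> T \<in> BH \<Longrightarrow> adj (S + T) = adj S + adj T"
  by (rule adj_eqI) (simp add: cinner_adj_right blinfun.add_left cinner_add_left cinner_add_right)

lemma adj_scale: "T \<in> BH \<Longrightarrow> adj (c *\<^sub>C T) = cnj c *\<^sub>C adj T"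
  by (rule adj_eqI)
    (simp add: cinner_adj_right scaleC_blinfun_apply cinner_scaleC_left cinner_scaleC_right)

lemma adj_id: "adj id_blinfun = id_blinfun"
  by (rule adj_eqI) simp

lemma norm_adj_le:
  assumes "T \<in> BH"
  shows "norm (adj T) \<le> norm T"
proof (rule norm_blinfun_bound)
  fix v
  have "(norm (adj T v))\<^sup>2 = T (adj T v) \<bullet> v"
    by (simp add: power2_norm_eq_inner inner_eq_Re_cinner cinner_adj_right [OF assms])
  also have "\<dots> \<le> norm (T (adj T v)) * norm v" by (rule norm_cauchy_schwarz)
  also have "\<dots> \<le> norm T * norm (adj T v) * norm v"
    by (intro mult_right_mono norm_blinfun) simp
  finally have "norm (adj T v) * norm (adj T v) \<le> norm (adj T v) * (norm T * norm v)"
    by (simp add: power2_eq_square mult_ac)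
  then show "norm (adj T v) \<le> norm T * norm v"
    by (cases "adj T v = 0") (auto simp: mult_le_cancel_left)
qed simp

section \<open>Tensor products of operators\<close>

lemma hilbert_tensor_add_left: "hilbert_tensor t \<Longrightarrow> t (a + a') b = t a b + t a' b"
  and hilbert_tensor_scaleC_left: "hilbert_tensor t \<Longrightarrow> t (c *\<^sub>C a) b = c *\<^sub>C t a b"
  and hilbert_tensor_scaleC_right: "hilbert_tensor t \<Longrightarrow> t a (c *\<^sub>C b) = c *\<^sub>C t a b"
  and cinner_hilbert_tensor:
    "hilbert_tensor t \<Longrightarrow> cinner (t a b) (t a' b') = cinner a a' * cinner b b'"
  and hilbert_tensor_dense: "hilbert_tensor t \<Longrightarrow> closure (span {t a b |a b. True}) = UNIV"
  unfolding hilbert_tensor_def by blast+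

lemma hilbert_tensor_scaleR_left:
  "hilbert_tensor t \<Longrightarrow> t (r *\<^sub>R a) b = r *\<^sub>R t a b"
  by (simp add: scaleR_scaleC hilbert_tensor_scaleC_left)

lemma hilbert_tensor_flip:
  assumes "hilbert_tensor t"
  shows "hilbert_tensor (\<lambda>b a. t a b)"
proof -
  have "{t a b |b a. True} = {t a b |a b. True}" by blast
  with assms show ?thesis
    unfolding hilbert_tensor_def by (simp add: mult.commute)
qed

lemma hilbert_tensor_sum_left:
  assumes "hilbert_tensor t"
  shows "t (sum f A) b = (\<Sum>i\<in>A. t (f i) b)"
proof -
  have "t 0 b = 0" using hilbert_tensor_add_left [OF assms, of 0 0 b] by simp
  then show ?thesis
    by (induction A rule: infinite_finite_induct) (auto simp: hilbert_tensor_add_left [OF assms])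
qed

lemma hilbert_tensor_sum_right:
  assumes "hilbert_tensor t"
  shows "t a (sum f A) = (\<Sum>i\<in>A. t a (f i))"
  using hilbert_tensor_sum_left [OF hilbert_tensor_flip [OF assms]] by simp

text \<open>Vectors \<open>e i\<close> may vanish: the coefficients of the projections are then \<open>0 / 0 = 0\<close>.\<close>

lemma gram_schmidt:
  fixes b :: "nat \<Rightarrow> 'h::complex_hilbert_space"
  shows "\<exists>e r. (\<forall>i<n. \<forall>j<n. i \<noteq> j \<longrightarrow> cinner (e i) (e j) = 0) \<and>
    (\<forall>j<n. b j = (\<Sum>i<n. r j i *\<^sub>C e i))"
proof (induction n)
  case (Suc n)
  then obtain e :: "nat \<Rightarrow> 'h" and r :: "nat \<Rightarrow> nat \<Rightarrow> complex"
    where orth: "\<And>i j. i < n \<Longrightarrow> j < n \<Longrightarrow> i \<noteq> j \<Longrightarrow> cinner (e i) (e j) = 0"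
      and rep: "\<And>j. j < n \<Longrightarrow> b j = (\<Sum>i<n. r j i *\<^sub>C e i)"
    by blast
  define c where "c i = cinner (b n) (e i) / cinner (e i) (e i)" for i
  define f where "f = b n - (\<Sum>i<n. c i *\<^sub>C e i)"
  have f_orth: "cinner f (e j) = 0" if "j < n" for j
  proof -
    have "(\<Sum>i<n. cinner (c i *\<^sub>C e i) (e j)) = (\<Sum>i<n. if i = j then cinner (b n) (e j) else 0)"
    proof (rule sum.cong [OF refl])
      fix i assume "i \<in> {..<n}"
      then show "cinner (c i *\<^sub>C e i) (e j) = (if i = j then cinner (b n) (e j) else 0)"
        using orth [of i j] that
        by (cases "e j = 0") (auto simp: c_def cinner_scaleC_left cinner_self)
    qed
    then show ?thesis using that by (simp add: f_def cinner_diff_left cinner_sum_left)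
  qed
  then have f_orth': "cinner (e j) f = 0" if "j < n" for j
    using that by (metis cinner_commute complex_cnj_zero)
  \<comment> \<open>Old rows are padded by \<open>0\<close> in column \<open>n\<close>. The new row
    solves the definition of \<open>f\<close> for \<open>b n\<close>: coefficients
    \<open>c i\<close> on the old vectors and \<open>1\<close> on \<open>f\<close>.\<close>
  define r' where "r' j i = (if j < n then if i < n then r j i else 0 else if i < n then c i else 1)"
    for j i
  show ?case
  proof (intro exI [of _ "e(n := f)"] exI [of _ r'] conjI allI impI)
    fix i j assume "i < Suc n" "j < Suc n" "i \<noteq> j"
    then show "cinner ((e(n := f)) i) ((e(n := f)) j) = 0"
      using f_orth f_orth' orth by (auto simp: less_Suc_eq)
  next
    fix j assume j: "j < Suc n"
    have "(\<Sum>i<Suc n. r' j i *\<^sub>C (e(n := f)) i)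
      = (\<Sum>i<n. r' j i *\<^sub>C e i) + r' j n *\<^sub>C f"
      by simp
    also have "\<dots> = b j"
      using j rep [of j] by (cases "j = n") (auto simp: r'_def scaleC_one scaleC_zero_left f_def)
    finally show "b j = (\<Sum>i<Suc n. r' j i *\<^sub>C (e(n := f)) i)" by simp
  qed
qed simp

text \<open>Pythagoras: each cross term carries a factor \<open>cinner (e i) (e j) = 0\<close>,
  whatever the first factors are. The \<open>e i\<close> are not normalised, hence the factors
  \<open>norm (e i)\<close>.\<close>

lemma norm_sum_hilbert_tensor_orthogonal:
  fixes n :: nat
  assumes t: "hilbert_tensor t"
    and orth: "\<And>i j. i < n \<Longrightarrow> j < n \<Longrightarrow> i \<noteq> j \<Longrightarrow> cinner (e i) (e j) = 0"
  shows "(norm (\<Sum>i<n. t (a i) (e i)))\<^sup>2 = (\<Sum>i<n. (norm (a i) * norm (e i))\<^sup>2)"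
proof -
  have "complex_of_real ((norm (\<Sum>i<n. t (a i) (e i)))\<^sup>2)
    = (\<Sum>i<n. \<Sum>j<n. cinner (t (a i) (e i)) (t (a j) (e j)))"
    by (simp only: cinner_self [symmetric] cinner_sum_left cinner_sum_right) (rule sum.swap)
  also have "\<dots> = (\<Sum>i<n. \<Sum>j<n. if i = j then complex_of_real ((norm (a i) * norm (e i))\<^sup>2) else 0)"
    using orth
    by (intro sum.cong refl) (auto simp: cinner_hilbert_tensor [OF t] cinner_self power_mult_distrib)
  also have "\<dots> = complex_of_real (\<Sum>i<n. (norm (a i) * norm (e i))\<^sup>2)" by simp
  finally show ?thesis by (simp only: of_real_eq_iff)
qed

lemma BH_sum_scaleC:
  assumes "x \<in> BH"
  shows "blinfun_apply x (\<Sum>i\<in>A. c i *\<^sub>C f i) = (\<Sum>i\<in>A. c i *\<^sub>C x (f i))"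
  by (simp add: blinfun.sum_right BH_scaleC [OF assms])

text \<open>Expanding the \<open>b j\<close> in an orthogonal system moves the coefficients to the
  first factors. There \<open>x\<close> acts on each orthogonal summand separately, so the bound
  \<open>norm x\<close> applies term by term.\<close>

lemma norm_sum_hilbert_tensor_le:
  fixes n :: nat
  assumes t: "hilbert_tensor t" and x: "x \<in> BH"
  shows "norm (\<Sum>j<n. t (blinfun_apply x (a j)) (b j)) \<le> norm x * norm (\<Sum>j<n. t (a j) (b j))"
proof -
  obtain e r where orth: "\<And>i j. i < n \<Longrightarrow> j < n \<Longrightarrow> i \<noteq> j \<Longrightarrow> cinner (e i) (e j) = 0"
    and rep: "\<And>j. j < n \<Longrightarrow> b j = (\<Sum>i<n. r j i *\<^sub>C e i)"
    using gram_schmidt [of n b] by blast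
  \<comment> \<open>Stated for arbitrary \<open>f\<close> because it is used for \<open>a\<close>
    and for its image under \<open>x\<close>, with the same \<open>r\<close> and
    \<open>e\<close>.\<close>
  have rewrite: "(\<Sum>j<n. t (f j) (b j)) = (\<Sum>i<n. t (\<Sum>j<n. r j i *\<^sub>C f j) (e i))" for f
  proof -
    have "(\<Sum>j<n. t (f j) (b j)) = (\<Sum>j<n. \<Sum>i<n. r j i *\<^sub>C t (f j) (e i))"
      by (intro sum.cong refl)
        (simp add: rep hilbert_tensor_sum_right [OF t] hilbert_tensor_scaleC_right [OF t])
    also have "\<dots> = (\<Sum>i<n. \<Sum>j<n. r j i *\<^sub>C t (f j) (e i))" by (rule sum.swap)
    also have "\<dots> = (\<Sum>i<n. t (\<Sum>j<n. r j i *\<^sub>C f j) (e i))"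
      by (simp add: hilbert_tensor_sum_left [OF t] hilbert_tensor_scaleC_left [OF t])
    finally show ?thesis .
  qed
  define c where "c i = (\<Sum>j<n. r j i *\<^sub>C a j)" for i
  have "(norm (\<Sum>j<n. t (x (a j)) (b j)))\<^sup>2 = (norm (\<Sum>i<n. t (x (c i)) (e i)))\<^sup>2"
    by (simp add: rewrite c_def BH_sum_scaleC [OF x])
  also have "\<dots> = (\<Sum>i<n. (norm (x (c i)) * norm (e i))\<^sup>2)"
    by (rule norm_sum_hilbert_tensor_orthogonal [OF t orth])
  also have "\<dots> \<le> (\<Sum>i<n. (norm x * norm (c i) * norm (e i))\<^sup>2)"
    by (intro sum_mono power_mono mult_right_mono norm_blinfun) auto
  also have "\<dots> = (norm x)\<^sup>2 * (\<Sum>i<n. (norm (c i) * norm (e i))\<^sup>2)"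
    by (simp add: sum_distrib_left power_mult_distrib mult.assoc)
  also have "\<dots> = (norm x)\<^sup>2 * (norm (\<Sum>i<n. t (c i) (e i)))\<^sup>2"
    by (simp add: norm_sum_hilbert_tensor_orthogonal [OF t orth])
  also have "\<dots> = (norm x * norm (\<Sum>j<n. t (a j) (b j)))\<^sup>2"
    by (simp add: rewrite c_def power_mult_distrib)
  finally show ?thesis by (rule power2_le_imp_le) simp
qed

section \<open>Density of elementary tensors and extension by continuity\<close>

text \<open>Agreement passes to the span by linearity and to its closure by continuity. The target
  space is arbitrary, so that the lemma applies to operators and to real functionals alike.\<close>

lemma bounded_linear_eq_hilbert_tensor:
  assumes t: "hilbert_tensor t" and f: "bounded_linear f" and g: "bounded_linear g"
    and eq: "\<And>a b. f (t a b) = g (t a b)"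
  shows "f u = (g u :: 'c::real_normed_vector)"
proof -
  have *: "f v = g v" if "v \<in> span {t a b |a b. True}" for v
    by (rule linear_eq_on_span [OF bounded_linear.linear [OF f] bounded_linear.linear [OF g] _ that])
      (auto simp: eq)
  obtain v where v: "\<And>n. v n \<in> span {t a b |a b. True}" "v \<longlonglongrightarrow> u"
    using hilbert_tensor_dense [OF t] closure_sequential [of u "span {t a b |a b. True}"] by auto
  have "(\<lambda>n. f (v n)) \<longlonglongrightarrow> f u"
    by (rule bounded_linear.tendsto [OF f v(2)])
  moreover have "(\<lambda>n. f (v n)) \<longlonglongrightarrow> g u"
    unfolding * [OF v(1)] by (rule bounded_linear.tendsto [OF g v(2)])
  ultimately show ?thesis by (rule LIMSEQ_unique)
qed

lemma blinfun_eq_hilbert_tensor: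
  assumes "hilbert_tensor t" "\<And>a b. blinfun_apply S (t a b) = blinfun_apply T (t a b)"
  shows "S = T"
  by (rule blinfun_eqI)
    (rule bounded_linear_eq_hilbert_tensor [where f = "blinfun_apply S" and g = "blinfun_apply T",
        OF assms(1) blinfun.bounded_linear_right blinfun.bounded_linear_right assms(2)])

text \<open>On \<open>D\<close> the map is \<open>K\<close>-Lipschitz, so it has a
  \<open>K\<close>-Lipschitz extension to the closure. Linearity of the extension follows by passing
  to limits of sequences in \<open>D\<close>, and the Lipschitz estimate against \<open>0\<close> is
  the norm bound.\<close>

lemma bounded_linear_extension:
  fixes g :: "'a::real_normed_vector \<Rightarrow> 'b::{real_normed_vector,complete_space}"
  assumes D: "subspace D" "closure D = UNIV"
    and add: "\<And>u v. u \<in> D \<Longrightarrow> v \<in> D \<Longrightarrow> g (u + v) = g u + g v"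
    and scale: "\<And>r u. u \<in> D \<Longrightarrow> g (r *\<^sub>R u) = r *\<^sub>R g u"
    and bound: "\<And>u. u \<in> D \<Longrightarrow> norm (g u) \<le> K * norm u" and K: "0 \<le> K"
  obtains G where "\<And>u. u \<in> D \<Longrightarrow> blinfun_apply G u = g u" "norm G \<le> K"
proof -
  have lip: "K-lipschitz_on D g"
  proof (rule lipschitz_onI [OF _ K])
    fix u v assume uv: "u \<in> D" "v \<in> D"
    have "g (u - v) = g u - g v"
      using add [of u "(- 1) *\<^sub>R v"] scale [of v "- 1"] uv D(1) by (simp add: subspace_neg)
    then show "dist (g u) (g v) \<le> K * dist u v"
      using bound [of "u - v"] uv D(1) by (simp add: dist_norm subspace_diff)
  qed
  obtain G where G: "K-lipschitz_on (closure D) G" and eq: "\<And>u. u \<in> D \<Longrightarrow> G u = g u"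
    using lipschitz_extend_closure [OF lip] by metis
  have "continuous_on UNIV G" using G D(2) lipschitz_on_continuous_on by metis
  then have cont: "(\<lambda>n. G (s n)) \<longlonglongrightarrow> G u" if "s \<longlonglongrightarrow> u" for s u
    using that by (simp add: continuous_on_eq_continuous_at isCont_tendsto_compose)
  have seq: "\<exists>s. (\<forall>n. s n \<in> D) \<and> s \<longlonglongrightarrow> u" for u
    using D(2) closure_sequential [of u D] by auto
  have "bounded_linear G"
  proof (rule bounded_linear_intro [where K = K])
    fix u v
    obtain s s' where s: "\<And>n. s n \<in> D" "s \<longlonglongrightarrow> u" "\<And>n. s' n \<in> D" "s' \<longlonglongrightarrow> v"
      using seq by metis
    have "(\<lambda>n. G (s n + s' n)) \<longlonglongrightarrow> G (u + v)" by (intro cont tendsto_add s)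
    moreover have "(\<lambda>n. G (s n + s' n)) \<longlonglongrightarrow> G u + G v"
      using tendsto_add [OF cont [OF s(2)] cont [OF s(4)]]
      by (simp add: eq s add subspace_add [OF D(1)])
    ultimately show "G (u + v) = G u + G v" by (rule LIMSEQ_unique)
  next
    fix r u
    obtain s where s: "\<And>n. s n \<in> D" "s \<longlonglongrightarrow> u" using seq by metis
    have "(\<lambda>n. G (r *\<^sub>R s n)) \<longlonglongrightarrow> G (r *\<^sub>R u)" by (intro cont tendsto_intros s)
    moreover have "(\<lambda>n. G (r *\<^sub>R s n)) \<longlonglongrightarrow> r *\<^sub>R G u"
      using tendsto_scaleR [OF tendsto_const cont [OF s(2)]]
      by (simp add: eq s scale subspace_scale [OF D(1)])
    ultimately show "G (r *\<^sub>R u) = r *\<^sub>R G u" by (rule LIMSEQ_unique)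
  next
    fix u
    have "G 0 = 0" using eq [of 0] scale [of 0 0] subspace_0 [OF D(1)] by simp
    then show "norm (G u) \<le> norm u * K"
      using lipschitz_onD [OF G, of u 0] D(2) by (simp add: mult.commute)
  qed
  note bl = this
  show thesis
  proof
    show "blinfun_apply (Blinfun G) u = g u" if "u \<in> D" for u
      using that by (simp add: bounded_linear_Blinfun_apply bl eq)
    have "G 0 = 0" using bl by (simp add: linear_simps)
    then have "norm (G u) \<le> K * norm u" for u
      using lipschitz_onD [OF G, of u 0] D(2) by simp
    then show "norm (Blinfun G) \<le> K"
      by (intro norm_blinfun_bound K) (simp add: bounded_linear_Blinfun_apply bl)
  qed
qed

section \<open>Existence, norm and adjoint of the tensor product of operators\<close>

lemma op_tensor_id_exists:
  fixes t :: "'g::complex_hilbert_space \<Rightarrow> 'h::complex_hilbert_space \<Rightarrow> 'k::complex_hilbert_space"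
  assumes t: "hilbert_tensor t" and x: "x \<in> BH"
  obtains z where "z \<in> BH" "\<And>a b. blinfun_apply z (t a b) = t (blinfun_apply x a) b"
    "norm z \<le> norm x"
proof -
  \<comment> \<open>A list of pairs is a formal sum of elementary tensors. With the identity for
    \<open>f\<close> it yields the vector represented, with \<open>x\<close> for \<open>f\<close>
    the intended image of that vector.\<close>
  define s where "s f L = (\<Sum>(a, b)\<leftarrow>L. t (f a) b)" for f :: "'g \<Rightarrow> 'g" and L
  have s_sum: "s f L = (\<Sum>j<length L. t (f (fst (L ! j))) (snd (L ! j)))" for f L
    by (simp add: s_def sum_list_sum_nth case_prod_beta atLeast0LessThan)
  have s_append: "s f (L @ L') = s f L + s f L'" for f L L' by (simp add: s_def)
  have s_scale: "s f (map (\<lambda>(a, b). (r *\<^sub>R a, b)) L) = r *\<^sub>R s f L"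
    if "\<And>a. f (r *\<^sub>R a) = r *\<^sub>R f a" for f r L
    by (induction L)
      (auto simp: s_def that hilbert_tensor_scaleR_left [OF t] scaleR_add_right)
  have s_bound: "norm (s x L) \<le> norm x * norm (s (\<lambda>a. a) L)" for L
    unfolding s_sum by (rule norm_sum_hilbert_tensor_le [OF t x])
  have s_cong: "s x L = s x L'" if "s (\<lambda>a. a) L = s (\<lambda>a. a) L'" for L L'
  proof -
    \<comment> \<open>The formal difference of \<open>L\<close> and \<open>L'\<close>, with the sign
      put on the first factors. It represents \<open>0\<close>, so \<open>s_bound\<close> forces its
      image to vanish.\<close>
    define L'' where "L'' = L @ map (\<lambda>(a, b). ((- 1) *\<^sub>R a, b)) L'"
    have "s f L'' = s f L - s f L'" if "\<And>a. f ((- 1) *\<^sub>R a) = (- 1) *\<^sub>R f a" for f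
    proof -
      have "s f (map (\<lambda>(a, b). ((- 1) *\<^sub>R a, b)) L') = (- 1) *\<^sub>R s f L'"
        by (rule s_scale) (rule that)
      then show ?thesis by (simp add: L''_def s_append)
    qed
    then have "s x L'' = s x L - s x L'" "s (\<lambda>a. a) L'' = s (\<lambda>a. a) L - s (\<lambda>a. a) L'"
      by (simp_all add: blinfun.minus_right)
    with s_bound [of L''] that show ?thesis by simp
  qed
  define D where "D = range (s (\<lambda>a. a))"
  \<comment> \<open>Any representing list may be chosen, by \<open>s_cong\<close>.\<close>
  define g where "g u = s x (SOME L. s (\<lambda>a. a) L = u)" for u
  have g: "g (s (\<lambda>a. a) L) = s x L" for L
    unfolding g_def by (rule s_cong) (rule someI [where P = "\<lambda>L'. s (\<lambda>a. a) L' = s (\<lambda>a. a) L" and x = L], rule refl)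
  have "subspace D"
  proof (rule subspaceI)
    show "0 \<in> D" unfolding D_def by (rule range_eqI [of _ _ "[]"]) (simp add: s_def)
    show "u + v \<in> D" if "u \<in> D" "v \<in> D" for u v
      using that unfolding D_def by (auto simp flip: s_append)
    show "r *\<^sub>R u \<in> D" if "u \<in> D" for r u
    proof -
      from that obtain L where "u = s (\<lambda>a. a) L" by (auto simp: D_def)
      then have "r *\<^sub>R u = s (\<lambda>a. a) (map (\<lambda>(a, b). (r *\<^sub>R a, b)) L)" by (simp add: s_scale)
      then show ?thesis by (simp add: D_def)
    qed
  qed
  moreover have "{t a b |a b. True} \<subseteq> D"
  proof clarify
    fix a b
    have "s (\<lambda>a. a) [(a, b)] = t a b" by (simp add: s_def)
    then show "t a b \<in> D" unfolding D_def by (metis rangeI)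
  qed
  ultimately have "closure (span {t a b |a b. True}) \<subseteq> closure D"
    by (intro closure_mono span_minimal)
  then have dense: "closure D = UNIV" using hilbert_tensor_dense [OF t] by blast
  obtain z where z: "\<And>u. u \<in> D \<Longrightarrow> blinfun_apply z u = g u" and norm_z: "norm z \<le> norm x"
  proof (rule bounded_linear_extension [OF \<open>subspace D\<close> dense, of g "norm x"])
    show "g (u + v) = g u + g v" if "u \<in> D" "v \<in> D" for u v
      using that unfolding D_def by (auto simp: g simp flip: s_append)
    show "g (r *\<^sub>R u) = r *\<^sub>R g u" if "u \<in> D" for r u
    proof -
      from that obtain L where L: "u = s (\<lambda>a. a) L" by (auto simp: D_def)
      have "r *\<^sub>R u = s (\<lambda>a. a) (map (\<lambda>(a, b). (r *\<^sub>R a, b)) L)" by (simp add: L s_scale)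
      then have "g (r *\<^sub>R u) = s x (map (\<lambda>(a, b). (r *\<^sub>R a, b)) L)" by (simp only: g)
      then show ?thesis by (simp add: L g s_scale blinfun.scaleR_right)
    qed
    show "norm (g u) \<le> norm x * norm u" if "u \<in> D" for u
      using that s_bound unfolding D_def by (auto simp: g)
  qed auto
  have zt: "blinfun_apply z (t a b) = t (x a) b" for a b
  proof -
    have "s (\<lambda>a. a) [(a, b)] = t a b" "s x [(a, b)] = t (x a) b" by (simp_all add: s_def)
    then show ?thesis using z g D_def by (metis rangeI)
  qed
  \<comment> \<open>The extension is only real-linear by construction. Complex linearity holds on
    elementary tensors, where the scalar can be absorbed into the first factor, and spreads by
    density.\<close>
  have "z (c *\<^sub>C u) = c *\<^sub>C z u" for c u
  proof (rule bounded_linear_eq_hilbert_tensor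
      [where f = "\<lambda>u. z (c *\<^sub>C u)" and g = "\<lambda>u. c *\<^sub>C z u", OF t])
    show "bounded_linear (\<lambda>u. z (c *\<^sub>C u))" "bounded_linear (\<lambda>u. c *\<^sub>C z u)"
      by (intro bounded_linear_compose [OF blinfun.bounded_linear_right]
          bounded_linear_compose [OF bounded_linear_scaleC]
          bounded_linear_scaleC blinfun.bounded_linear_right)+
    show "z (c *\<^sub>C t a b) = c *\<^sub>C z (t a b)" for a b
      by (simp add: zt BH_scaleC [OF x] flip: hilbert_tensor_scaleC_left [OF t])
  qed
  then have "z \<in> BH" by (simp add: BH_def)
  then show thesis using zt norm_z by (rule that)
qed

text \<open>The product of \<open>x \<otimes> 1\<close> and \<open>1 \<otimes> y\<close>; the latter
  comes from exchanging the roles of the two factors.\<close>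

lemma op_tensor_exists:
  fixes t :: "'g::complex_hilbert_space \<Rightarrow> 'h::complex_hilbert_space \<Rightarrow> 'k::complex_hilbert_space"
  assumes t: "hilbert_tensor t" and x: "x \<in> BH" and y: "y \<in> BH"
  obtains z where "z \<in> BH" "\<And>a b. blinfun_apply z (t a b) = t (blinfun_apply x a) (blinfun_apply y b)"
    "norm z \<le> norm x * norm y"
proof -
  obtain z where z: "z \<in> BH" "\<And>a b. blinfun_apply z (t a b) = t (x a) b" "norm z \<le> norm x"
    using op_tensor_id_exists [OF t x] by metis
  obtain w where w: "w \<in> BH" "\<And>a b. blinfun_apply w (t a b) = t a (y b)" "norm w \<le> norm y"
    using op_tensor_id_exists [OF hilbert_tensor_flip [OF t] y] by metis
  have "norm (z o\<^sub>L w) \<le> norm z * norm w" by (rule norm_blinfun_compose)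
  also have "\<dots> \<le> norm x * norm y" using z(3) w(3) by (simp add: mult_mono)
  finally show thesis using z w by (intro that [of "z o\<^sub>L w"] BH_compose) auto
qed

lemma op_tensor_eqI:
  assumes "hilbert_tensor t" "z \<in> BH"
    "\<And>a b. blinfun_apply z (t a b) = t (blinfun_apply x a) (blinfun_apply y b)"
  shows "op_tensor t x y = z"
  unfolding op_tensor_def using assms
  by (intro the_equality) (auto intro: blinfun_eq_hilbert_tensor)

lemma
  assumes t: "hilbert_tensor t" and x: "x \<in> BH" and y: "y \<in> BH"
  shows op_tensor_BH: "op_tensor t x y \<in> BH"
    and op_tensor_apply: "blinfun_apply (op_tensor t x y) (t a b) = t (blinfun_apply x a) (blinfun_apply y b)"
    and norm_op_tensor_le: "norm (op_tensor t x y) \<le> norm x * norm y"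
proof -
  obtain z where "z \<in> BH" "\<And>a b. blinfun_apply z (t a b) = t (x a) (y b)" "norm z \<le> norm x * norm y"
    using op_tensor_exists [OF t x y] by metis
  moreover from this have "op_tensor t x y = z" by (intro op_tensor_eqI [OF t])
  ultimately show "op_tensor t x y \<in> BH"
    "blinfun_apply (op_tensor t x y) (t a b) = t (x a) (y b)" "norm (op_tensor t x y) \<le> norm x * norm y"
    by simp_all
qed

text \<open>Density is used in both arguments of the inner product: operators are compared on
  elementary tensors \<open>t a b\<close>, and the resulting vectors by pairing with elementary
  tensors \<open>t a' b'\<close>, where the inner product factorises.\<close>

lemma adj_op_tensor:
  fixes t :: "'g::complex_hilbert_space \<Rightarrow> 'h::complex_hilbert_space \<Rightarrow> 'k::complex_hilbert_space"
  assumes t: "hilbert_tensor t" and x: "x \<in> BH" and y: "y \<in> BH"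
  shows "adj (op_tensor t x y) = op_tensor t (adj x) (adj y)"
proof (rule blinfun_eq_hilbert_tensor [OF t])
  fix a b
  let ?z = "op_tensor t x y" and ?w = "op_tensor t (adj x) (adj y)"
  have "u \<bullet> blinfun_apply (adj ?z) (t a b) = u \<bullet> blinfun_apply ?w (t a b)" for u
  proof (rule bounded_linear_eq_hilbert_tensor [OF t,
        where f = "\<lambda>u. u \<bullet> blinfun_apply (adj ?z) (t a b)"
          and g = "\<lambda>u. u \<bullet> blinfun_apply ?w (t a b)"])
    show "t a' b' \<bullet> blinfun_apply (adj ?z) (t a b) = t a' b' \<bullet> blinfun_apply ?w (t a b)" for a' b'
      by (simp add: inner_eq_Re_cinner op_tensor_apply [OF t] x y adj_BH cinner_hilbert_tensor [OF t]
          flip: cinner_adj_right [OF op_tensor_BH [OF t x y]] cinner_adj_right [OF x] cinner_adj_right [OF y])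
  qed (rule bounded_linear_inner_left)+
  then show "blinfun_apply (adj ?z) (t a b) = blinfun_apply ?w (t a b)"
    using vector_eq_ldot by blast
qed

section \<open>Von Neumann algebras and normal states\<close>

lemma commutant_subset_BH: "commutant S \<subseteq> BH"
  by (auto simp: commutant_def)

lemma commutant_antimono: "S \<subseteq> T \<Longrightarrow> commutant T \<subseteq> commutant S"
  by (auto simp: commutant_def)

lemma subset_bicommutant: "S \<subseteq> BH \<Longrightarrow> S \<subseteq> commutant (commutant S)"
  by (auto simp: commutant_def)

lemma commutant_adj:
  assumes "S \<subseteq> BH" "\<And>x. x \<in> S \<Longrightarrow> adj x \<in> S" "y \<in> commutant S"
  shows "adj y \<in> commutant S"
proof -
  have y: "y \<in> BH" using assms(3) by (simp add: commutant_def)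
  have "x o\<^sub>L adj y = adj y o\<^sub>L x" if "x \<in> S" for x
  proof -
    have x: "x \<in> BH" using that assms(1) by blast
    have "adj x o\<^sub>L y = y o\<^sub>L adj x" using assms that by (simp add: commutant_def)
    then have "adj (adj x o\<^sub>L y) = adj (y o\<^sub>L adj x)" by simp
    then show ?thesis by (simp add: adj_compose adj_adj adj_BH x y)
  qed
  then show ?thesis using y by (simp add: commutant_def adj_BH)
qed

text \<open>A third commutant is the first: one inclusion is the bicommutant inclusion for
  \<open>S\<close> with the order reversed, the other is the same inclusion for
  \<open>commutant S\<close>.\<close>

lemma von_neumann_algebra_commutant:
  assumes "S \<subseteq> BH" "\<And>x. x \<in> S \<Longrightarrow> adj x \<in> S"
  shows "von_neumann_algebra (commutant S)"
  unfolding von_neumann_algebra_def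
proof (intro conjI ballI)
  show "commutant (commutant (commutant S)) = commutant S"
  proof
    show "commutant (commutant (commutant S)) \<subseteq> commutant S"
      by (intro commutant_antimono subset_bicommutant assms(1))
    show "commutant S \<subseteq> commutant (commutant (commutant S))"
      by (rule subset_bicommutant [OF commutant_subset_BH])
  qed
qed (use assms commutant_subset_BH commutant_adj in blast)+

context
  fixes N :: "'h::complex_hilbert_space op set"
  assumes N: "von_neumann_algebra N"
begin

lemma von_neumann_algebra_BH: "x \<in> N \<Longrightarrow> x \<in> BH"
  using N by (auto simp: von_neumann_algebra_def)

lemma von_neumann_algebra_adj: "x \<in> N \<Longrightarrow> adj x \<in> N"
  using N by (auto simp: von_neumann_algebra_def)

text \<open>The definition mentions adjoints and the bicommutant but no sums or products. Their
  membership is obtained here, by checking that they commute with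
  \<open>commutant N\<close>.\<close>

lemma von_neumann_algebraI:
  assumes "y \<in> BH" "\<And>x u. x \<in> commutant N \<Longrightarrow> blinfun_apply x (y u) = y (x u)"
  shows "y \<in> N"
proof -
  have "y \<in> commutant (commutant N)"
    unfolding commutant_def [of "commutant N"] using assms by (auto intro!: blinfun_eqI)
  then show ?thesis using N by (simp add: von_neumann_algebra_def)
qed

lemma commutant_commutes:
  assumes "y \<in> N" "x \<in> commutant N"
  shows "blinfun_apply x (y u) = y (x u)"
proof -
  have "y o\<^sub>L x = x o\<^sub>L y" using assms by (simp add: commutant_def)
  then have "(y o\<^sub>L x) u = (x o\<^sub>L y) u" by (rule arg_cong)
  then show ?thesis by simp
qed

lemma commutant_BH: "x \<in> commutant N \<Longrightarrow> x \<in> BH"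
  by (simp add: commutant_def)

lemma von_neumann_algebra_id: "id_blinfun \<in> N"
  by (rule von_neumann_algebraI) (auto simp: BH_id)

lemma von_neumann_algebra_compose: "x \<in> N \<Longrightarrow> y \<in> N \<Longrightarrow> x o\<^sub>L y \<in> N"
  by (rule von_neumann_algebraI)
    (auto simp: von_neumann_algebra_BH BH_compose commutant_commutes [of x] commutant_commutes [of y])

lemma von_neumann_algebra_plus: "x \<in> N \<Longrightarrow> y \<in> N \<Longrightarrow> x + y \<in> N"
  by (rule von_neumann_algebraI)
    (auto simp: von_neumann_algebra_BH BH_plus commutant_commutes [of x] commutant_commutes [of y] blinfun.add_left blinfun.add_right)

lemma von_neumann_algebra_minus: "x \<in> N \<Longrightarrow> y \<in> N \<Longrightarrow> x - y \<in> N"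
  by (rule von_neumann_algebraI)
    (auto simp: von_neumann_algebra_BH BH_minus commutant_commutes [of x] commutant_commutes [of y] blinfun.diff_left
      blinfun.diff_right)

lemma von_neumann_algebra_scale: "x \<in> N \<Longrightarrow> c *\<^sub>C x \<in> N"
  by (rule von_neumann_algebraI)
    (auto simp: von_neumann_algebra_BH BH_scale commutant_commutes [of x] scaleC_blinfun_apply
      BH_scaleC commutant_BH)

section \<open>Positivity of states and the Cauchy-Schwarz inequality\<close>

context
  fixes \<Phi> :: "'h op \<Rightarrow> complex"
  assumes \<Phi>: "state_on N \<Phi>"
begin

lemma state_plus: "x \<in> N \<Longrightarrow> y \<in> N \<Longrightarrow> \<Phi> (x + y) = \<Phi> x + \<Phi> y"
  using \<Phi> by (simp add: state_on_def linear_functional_on_def)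

lemma state_scale: "x \<in> N \<Longrightarrow> \<Phi> (c *\<^sub>C x) = c * \<Phi> x"
  using \<Phi> by (simp add: state_on_def linear_functional_on_def)

lemma state_minus:
  assumes "x \<in> N" "y \<in> N"
  shows "\<Phi> (x - y) = \<Phi> x - \<Phi> y"
  using state_plus [of "x - y" y] assms by (simp add: von_neumann_algebra_minus)

lemma state_id: "\<Phi> id_blinfun = 1"
  using \<Phi> by (simp add: state_on_def)

lemma state_nonneg: "x \<in> N \<Longrightarrow> 0 \<le> \<Phi> (adj x o\<^sub>L x)"
  using \<Phi> by (simp add: state_on_def)

text \<open>Positivity on \<open>x + l *\<^sub>C y\<close> for all complex \<open>l\<close>, reduced
  to a real quadratic inequality in one parameter.\<close>

lemma state_Cauchy_Schwarz:
  assumes x: "x \<in> N" and y: "y \<in> N"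
  shows "(cmod (\<Phi> (adj x o\<^sub>L y)))\<^sup>2 \<le> Re (\<Phi> (adj x o\<^sub>L x)) * Re (\<Phi> (adj y o\<^sub>L y))"
proof -
  define a b c d where "a = \<Phi> (adj x o\<^sub>L x)" and "b = \<Phi> (adj y o\<^sub>L y)"
    and "c = \<Phi> (adj x o\<^sub>L y)" and "d = \<Phi> (adj y o\<^sub>L x)"
  note N_intros = von_neumann_algebra_compose von_neumann_algebra_adj von_neumann_algebra_plus
    von_neumann_algebra_scale x y
  have expand: "0 \<le> a + l * c + cnj l * d + cnj l * l * b" for l
  proof -
    have "adj (x + l *\<^sub>C y) o\<^sub>L (x + l *\<^sub>C y) = (adj x o\<^sub>L x) + l *\<^sub>C (adj x o\<^sub>L y)
      + cnj l *\<^sub>C (adj y o\<^sub>L x) + (cnj l * l) *\<^sub>C (adj y o\<^sub>L y)"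
      using von_neumann_algebra_BH [OF x] von_neumann_algebra_BH [OF y]
      by (intro blinfun_eqI)
        (simp add: adj_plus adj_scale BH_scale adj_BH blinfun.add_left blinfun.add_right
          scaleC_blinfun_apply BH_scaleC scaleC_add_right scaleC_scaleC)
    then show ?thesis
      using state_nonneg [of "x + l *\<^sub>C y"]
      by (simp add: N_intros state_plus state_scale a_def b_def c_def d_def)
  qed
  have a: "0 \<le> a" and b: "0 \<le> b" unfolding a_def b_def by (intro state_nonneg x y)+
  have im: "Im a = 0" "Im b = 0" using a b by (simp_all add: less_eq_complex_def)
  \<comment> \<open>Hermitian symmetry is not part of \<open>state_on\<close>. The order on complex
    numbers forces the expanded value to be real: \<open>l = 1\<close> compares imaginary parts of
    \<open>c\<close> and \<open>d\<close>, \<open>l = \<i>\<close> their real parts.\<close>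
  have d: "d = cnj c"
    using expand [of 1] expand [of \<i>] by (simp add: less_eq_complex_def complex_eq_iff im)
  have quad: "0 \<le> Re a + 2 * s * (cmod c)\<^sup>2 + s\<^sup>2 * (cmod c)\<^sup>2 * Re b" for s :: real
  proof -
    \<comment> \<open>This phase makes the two cross terms real and equal.\<close>
    define l where "l = complex_of_real s * cnj c"
    have "l * c = complex_of_real (s * (cmod c)\<^sup>2)" "cnj l * d = complex_of_real (s * (cmod c)\<^sup>2)"
      "cnj l * l = complex_of_real (s\<^sup>2 * (cmod c)\<^sup>2)"
      unfolding of_real_mult complex_norm_square l_def d
      by (simp_all add: power2_eq_square mult_ac)
    then have "0 \<le> a + complex_of_real (s * (cmod c)\<^sup>2) + complex_of_real (s * (cmod c)\<^sup>2)
      + complex_of_real (s\<^sup>2 * (cmod c)\<^sup>2) * b"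
      using expand [of l] by (simp only:)
    then show ?thesis by (simp only: less_eq_complex_def) simp
  qed
  have "(cmod c)\<^sup>2 \<le> Re a * Re b"
  proof (cases "Re b = 0")
    case True
    have "c = 0"
    proof (rule ccontr)
      assume "c \<noteq> 0"
      then show False
        \<comment> \<open>With \<open>Re b = 0\<close> the expression is affine in \<open>s\<close>;
          here it takes the negative value \<open>- Re a - 2\<close>.\<close>
        using quad [of "- (Re a + 1) / (cmod c)\<^sup>2"] a True
        by (simp add: less_eq_complex_def)
    qed
    then show ?thesis using True by simp
  next
    case False
    then have "0 < Re b" using b by (simp add: less_eq_complex_def)
    then show ?thesis
      \<comment> \<open>The minimiser of the quadratic when \<open>c\<close> is nonzero.\<close>
      using quad [of "- 1 / Re b"] by (simp add: field_simps power2_eq_square)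
  qed
  then show ?thesis by (simp add: a_def b_def c_def)
qed

end

text \<open>For \<open>x \<le> s\<close> the supremum of the directed set \<open>{x, s}\<close> is \<open>s\<close>, so that normality gives
  monotonicity without square roots of positive operators.\<close>

lemma normal_state_mono:
  assumes \<Phi>: "normal_state N \<Phi>"
    and x: "x \<in> self_adjoint_part N" and s: "s \<in> self_adjoint_part N" and le: "positive_op (s - x)"
  shows "Re (\<Phi> x) \<le> Re (\<Phi> s)"
proof -
  have "positive_op (0 :: 'h op)" by (simp add: positive_op_def BH_def)
  then have "directed {x, s}" "is_lub_in (self_adjoint_part N) {x, s} s"
    using s le by (auto simp: directed_def is_lub_in_def)
  then have "Re (\<Phi> s) = (SUP y\<in>{x, s}. Re (\<Phi> y))"
    using \<Phi> x s unfolding normal_state_def by (metis empty_subsetI insert_subset)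
  then show ?thesis using cSup_upper [of "Re (\<Phi> x)" "{Re (\<Phi> x), Re (\<Phi> s)}"] by simp
qed

text \<open>The quadratic form of the squared norm of \<open>x\<close> times the identity, minus
  \<open>adj x o\<^sub>L x\<close>, is the gap in \<open>norm (x v) \<le> norm x * norm v\<close>
  after squaring; monotonicity then applies.\<close>

lemma normal_state_le_norm:
  assumes \<Phi>: "normal_state N \<Phi>" and x: "x \<in> N"
  shows "Re (\<Phi> (adj x o\<^sub>L x)) \<le> (norm x)\<^sup>2"
proof -
  have x_BH: "x \<in> BH" using x by (rule von_neumann_algebra_BH)
  have st: "state_on N \<Phi>" using \<Phi> by (simp add: normal_state_def)
  let ?s = "complex_of_real ((norm x)\<^sup>2) *\<^sub>C id_blinfun"
  have "positive_op (?s - (adj x o\<^sub>L x))"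
    unfolding positive_op_def
  proof (intro conjI allI)
    show "?s - (adj x o\<^sub>L x) \<in> BH"
      by (intro BH_minus BH_scale BH_id BH_compose adj_BH x_BH)
    fix v
    have "cinner ((?s - (adj x o\<^sub>L x)) v) v
      = complex_of_real ((norm x)\<^sup>2) * cinner v v - cinner (x v) (x v)"
      by (simp add: blinfun.diff_left cinner_diff_left scaleC_blinfun_apply cinner_scaleC_left
          cinner_adj_left [OF x_BH])
    also have "\<dots> = complex_of_real ((norm x * norm v)\<^sup>2 - (norm (x v))\<^sup>2)"
      by (simp add: cinner_self power_mult_distrib)
    also have "0 \<le> \<dots>"
      using power_mono [OF norm_blinfun [of x v], of 2] by (simp add: less_eq_complex_def)
    finally show "0 \<le> cinner ((?s - (adj x o\<^sub>L x)) v) v" .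
  qed
  moreover have "adj x o\<^sub>L x \<in> self_adjoint_part N" "?s \<in> self_adjoint_part N"
    by (simp_all add: self_adjoint_part_def von_neumann_algebra_compose von_neumann_algebra_adj
        von_neumann_algebra_scale von_neumann_algebra_id x adj_compose adj_BH x_BH adj_adj
        adj_scale BH_id adj_id)
  ultimately have "Re (\<Phi> (adj x o\<^sub>L x)) \<le> Re (\<Phi> ?s)"
    by (intro normal_state_mono [OF \<Phi>])
  then show ?thesis by (simp add: state_scale [OF st] state_id [OF st] von_neumann_algebra_id)
qed

lemma normal_state_compose_projection:
  assumes \<Phi>: "normal_state N \<Phi>" and q: "q \<in> N" "projection q" and x: "x \<in> N"
  shows "cmod (\<Phi> (q o\<^sub>L x)) \<le> norm x * sqrt (Re (\<Phi> q))"
    and "cmod (\<Phi> (x o\<^sub>L q)) \<le> norm x * sqrt (Re (\<Phi> q))"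
proof -
  have st: "state_on N \<Phi>" using \<Phi> by (simp add: normal_state_def)
  have qq: "adj q o\<^sub>L q = q" and adj_q: "adj q = q" using q(2) by (simp_all add: projection_def)
  have q0: "0 \<le> Re (\<Phi> q)" using state_nonneg [OF st q(1)] by (simp add: qq less_eq_complex_def)
  have x_BH: "x \<in> BH" using x by (rule von_neumann_algebra_BH)
  \<comment> \<open>Common end of both estimates. Cauchy-Schwarz pairs \<open>q\<close> with
    \<open>x\<close> in one and \<open>adj x\<close> with \<open>q\<close> in the other, so
    \<open>y\<close> is \<open>x\<close> or \<open>adj x\<close>; the remaining factor is
    \<open>\<Phi> q\<close> because \<open>q\<close> is idempotent and self-adjoint.\<close>
  have *: "c \<le> norm x * sqrt (Re (\<Phi> q))"
    if "c\<^sup>2 \<le> Re (\<Phi> (adj y o\<^sub>L y)) * Re (\<Phi> q)" "y \<in> N" "norm y \<le> norm x" for c y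
  proof (rule power2_le_imp_le)
    have "Re (\<Phi> (adj y o\<^sub>L y)) \<le> (norm x)\<^sup>2"
      using normal_state_le_norm [OF \<Phi> that(2)] power_mono [OF that(3) norm_ge_zero, of 2]
      by (rule order_trans)
    then show "c\<^sup>2 \<le> (norm x * sqrt (Re (\<Phi> q)))\<^sup>2"
      using that(1) mult_right_mono [OF _ q0] q0 by (fastforce simp: power_mult_distrib)
  qed (simp add: q0)
  show "cmod (\<Phi> (q o\<^sub>L x)) \<le> norm x * sqrt (Re (\<Phi> q))"
    by (rule * [of _ x]) (use state_Cauchy_Schwarz [OF st q(1) x] x in \<open>simp_all add: adj_q qq [unfolded adj_q] mult.commute\<close>)
  show "cmod (\<Phi> (x o\<^sub>L q)) \<le> norm x * sqrt (Re (\<Phi> q))"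
    by (rule * [of _ "adj x"])
      (use state_Cauchy_Schwarz [OF st von_neumann_algebra_adj [OF x] q(1)] x in
        \<open>simp_all add: qq adj_adj x_BH von_neumann_algebra_adj norm_adj_le\<close>)
qed

end

section \<open>Projections, the tensor product algebra and the conjugation\<close>

lemma norm_projection_le:
  assumes "projection p"
  shows "norm p \<le> 1"
proof (rule norm_blinfun_bound)
  fix v
  have p: "p \<in> BH" "adj p = p" "p o\<^sub>L p = p" using assms by (auto simp: projection_def)
  have "(norm (p v))\<^sup>2 = p v \<bullet> v"
    using cinner_adj_right [OF p(1), of v "p v"] cinner_commute [of v "p v"]
    by (simp add: power2_norm_eq_inner inner_eq_Re_cinner p(2)
        flip: blinfun_apply_blinfun_compose [of p p v, unfolded p(3)])
  also have "\<dots> \<le> norm (p v) * norm v" by (rule norm_cauchy_schwarz)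
  finally show "norm (p v) \<le> 1 * norm v"
    by (cases "p v = 0") (auto simp: power2_eq_square)
qed simp

lemma projection_complement:
  assumes "projection p"
  shows "projection (id_blinfun - p)"
proof -
  have p: "p \<in> BH" "adj p = p" "p o\<^sub>L p = p" using assms by (auto simp: projection_def)
  have "blinfun_apply p (p v) = p v" for v
    using p(3) by (metis blinfun_apply_blinfun_compose)
  then have "(id_blinfun - p) o\<^sub>L (id_blinfun - p) = id_blinfun - p"
    by (intro blinfun_eqI) (simp add: blinfun.diff_left blinfun.diff_right)
  then show ?thesis by (simp add: projection_def BH_minus BH_id p adj_minus adj_id)
qed

text \<open>Elementary tensors of operators are closed under adjoints, hence so is their commutant,
  and the commutant of an adjoint-closed set is a von Neumann algebra.\<close>

lemma
  assumes t: "hilbert_tensor t" and M: "von_neumann_algebra M" and N: "von_neumann_algebra N"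
  shows von_neumann_algebra_vn_tensor: "von_neumann_algebra (vn_tensor t M N)"
    and op_tensor_in_vn_tensor: "x \<in> M \<Longrightarrow> y \<in> N \<Longrightarrow> op_tensor t x y \<in> vn_tensor t M N"
proof -
  let ?G = "{op_tensor t x y |x y. x \<in> M \<and> y \<in> N}"
  have G: "?G \<subseteq> BH"
    by (auto intro: op_tensor_BH [OF t] von_neumann_algebra_BH [OF M] von_neumann_algebra_BH [OF N])
  have "adj z \<in> ?G" if "z \<in> ?G" for z
  proof -
    from that obtain x y where z: "z = op_tensor t x y" "x \<in> M" "y \<in> N" by blast
    then have "adj z = op_tensor t (adj x) (adj y)"
      by (simp add: adj_op_tensor [OF t] von_neumann_algebra_BH [OF M] von_neumann_algebra_BH [OF N])
    then show ?thesis using z von_neumann_algebra_adj [OF M] von_neumann_algebra_adj [OF N] by blast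
  qed
  then have "\<And>y. y \<in> commutant ?G \<Longrightarrow> adj y \<in> commutant ?G" by (rule commutant_adj [OF G])
  then show "von_neumann_algebra (vn_tensor t M N)"
    unfolding vn_tensor_def by (intro von_neumann_algebra_commutant commutant_subset_BH)
  show "op_tensor t x y \<in> vn_tensor t M N" if "x \<in> M" "y \<in> N"
    unfolding vn_tensor_def using subset_bicommutant [OF G] that by blast
qed

text \<open>Polarisation shows that \<open>J\<close> preserves the real inner product, that is, real
  parts. Imaginary parts change sign since \<open>J\<close> turns multiplication by
  \<open>\<i>\<close> into multiplication by \<open>- \<i>\<close>.\<close>

lemma antilinear_isometry_cinner:
  assumes J: "antilinear_op J" "\<And>v. norm (blinfun_apply J v) = norm v"
  shows "cinner (blinfun_apply J u) (J v) = cnj (cinner u v)"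
proof -
  have inner: "J u \<bullet> J v = u \<bullet> v" for u v
    using J(2) [of "u + v"] J(2) [of u] J(2) [of v]
    by (simp add: dot_norm blinfun.add_right [symmetric])
  have "J (\<i> *\<^sub>C u) = - (\<i> *\<^sub>C J u)"
  proof -
    have "J (\<i> *\<^sub>C u) = ((- 1) * \<i>) *\<^sub>C J u" using J(1) by (simp add: antilinear_op_def)
    then show ?thesis by (simp only: scaleC_scaleC [symmetric] scaleC_minus_one)
  qed
  then have "(\<i> *\<^sub>C J u) \<bullet> J v = - ((\<i> *\<^sub>C u) \<bullet> v)" using inner [of "\<i> *\<^sub>C u" v] by simp
  then show ?thesis
    using inner [of u v] by (intro complex_eqI) (simp_all add: Im_cinner flip: inner_eq_Re_cinner)
qed

section \<open>The coupling inequality\<close>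

lemma normal_state_compression_zero:
  assumes N: "von_neumann_algebra N" and \<Phi>: "normal_state N \<Phi>"
    and p: "p \<in> N" "projection p" and x: "x \<in> N" and zero: "p o\<^sub>L x o\<^sub>L p = 0"
    and K: "norm x \<le> K"
  shows "cmod (\<Phi> x) \<le> 2 * K * sqrt (1 - Re (\<Phi> p))"
proof -
  have st: "state_on N \<Phi>" using \<Phi> by (simp add: normal_state_def)
  define q where "q = id_blinfun - p"
  have q: "q \<in> N" "projection q"
    unfolding q_def
    by (intro von_neumann_algebra_minus von_neumann_algebra_id projection_complement p N)+
  have px: "p o\<^sub>L x \<in> N" using p(1) x by (rule von_neumann_algebra_compose [OF N])
  have "norm (p o\<^sub>L x) \<le> norm p * norm x" by (rule norm_blinfun_compose)
  also have "\<dots> \<le> norm x"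
    using mult_right_mono [OF norm_projection_le [OF p(2)] norm_ge_zero [of x]] by simp
  finally have norm_px: "norm (p o\<^sub>L x) \<le> norm x" .
  have "blinfun_apply p (x (p v)) = 0" for v
    using zero by (metis blinfun_apply_blinfun_compose zero_blinfun.rep_eq)
  \<comment> \<open>Of the decomposition into \<open>q x\<close>, \<open>p x q\<close> and
    \<open>p x p\<close> the last corner is absent. In the second term \<open>p x\<close> is taken
    as one operator of norm at most \<open>norm x\<close>, followed by the projection
    \<open>q\<close> on the right.\<close>
  then have "x = (q o\<^sub>L x) + ((p o\<^sub>L x) o\<^sub>L q)"
    by (intro blinfun_eqI) (simp add: q_def blinfun.add_left blinfun.diff_left blinfun.diff_right)
  then have "\<Phi> x = \<Phi> (q o\<^sub>L x) + \<Phi> ((p o\<^sub>L x) o\<^sub>L q)"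
    using state_plus [OF N st, of "q o\<^sub>L x" "(p o\<^sub>L x) o\<^sub>L q"] q(1) px x
      von_neumann_algebra_compose [OF N] by simp
  then have "cmod (\<Phi> x) \<le> cmod (\<Phi> (q o\<^sub>L x)) + cmod (\<Phi> ((p o\<^sub>L x) o\<^sub>L q))"
    by (simp add: norm_triangle_ineq)
  also have "\<dots> \<le> norm x * sqrt (Re (\<Phi> q)) + norm (p o\<^sub>L x) * sqrt (Re (\<Phi> q))"
    by (intro add_mono normal_state_compose_projection [OF N \<Phi> q] x px)
  also have "\<dots> \<le> K * sqrt (Re (\<Phi> q)) + K * sqrt (Re (\<Phi> q))"
  proof -
    have "0 \<le> Re (\<Phi> q)"
      using state_nonneg [OF N st q(1)] q(2) by (simp add: projection_def less_eq_complex_def)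
    then show ?thesis using norm_px K by (intro add_mono mult_right_mono) simp_all
  qed
  also have "Re (\<Phi> q) = 1 - Re (\<Phi> p)"
    by (simp add: q_def state_minus [OF N st] state_id [OF N st] von_neumann_algebra_id [OF N] p)
  finally show ?thesis by simp
qed

text \<open>\<open>Re\<close> loses nothing: \<open>p\<close> equals
  \<open>adj p o\<^sub>L p\<close>, so \<open>\<Phi> p\<close> is a nonnegative real. The opposite
  state is the vector functional of \<open>\<xi>\<^sub>\<psi>\<close> read on
  \<open>commutant M\<close>.\<close>

theorem theorem4p2:
  fixes M :: "'h::complex_hilbert_space op set"
    and J :: "'h op"
    and P :: "'h set"
    and t :: "'h \<Rightarrow> 'h \<Rightarrow> 'k::complex_hilbert_space"
    and \<phi> \<psi> :: "'h op \<Rightarrow> complex"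
    and \<xi>\<^sub>\<psi> :: 'h
    and \<Phi> :: "'k op \<Rightarrow> complex"
    and p :: "'k op"
  assumes "standard_form M J P"
    and "hilbert_tensor t"
    and "normal_state M \<phi>"
    and "normal_state M \<psi>"
    and "standard_GNS_vector M P \<psi> \<xi>\<^sub>\<psi>"
    and "coupling t M (commutant M) \<phi> (vector_functional \<xi>\<^sub>\<psi>) \<Phi>"
    and "diagonal_projection t M J p"
  shows "functional_norm M (\<lambda>x. \<phi> x - \<psi> x) \<le> 4 * sqrt (1 - Re (\<Phi> p))"
proof -
  note t = \<open>hilbert_tensor t\<close>
  have M: "von_neumann_algebra M" and J: "antilinear_op J" "\<And>v. norm (J v) = norm v"
    and JMJ: "(\<lambda>x. J o\<^sub>L x o\<^sub>L J) ` M = commutant M" and J_fix: "\<forall>v\<in>P. J v = v"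
    using assms(1) unfolding standard_form_def by simp_all
  have \<xi>: "\<xi>\<^sub>\<psi> \<in> P" "\<And>x. x \<in> M \<Longrightarrow> \<psi> x = cinner (x \<xi>\<^sub>\<psi>) \<xi>\<^sub>\<psi>"
    using assms(5) by (auto simp: standard_GNS_vector_def vector_functional_def)
  have M': "von_neumann_algebra (commutant M)"
    using von_neumann_algebra_BH [OF M] von_neumann_algebra_adj [OF M]
    by (intro von_neumann_algebra_commutant) auto
  note N = von_neumann_algebra_vn_tensor [OF t M M']
  have \<Phi>: "normal_state (vn_tensor t M (commutant M)) \<Phi>"
    and \<Phi>_left: "\<And>x. x \<in> M \<Longrightarrow> \<Phi> (op_tensor t x id_blinfun) = \<phi> x"
    and \<Phi>_right: "\<And>y. y \<in> commutant M \<Longrightarrow> \<Phi> (op_tensor t id_blinfun y) = cinner (y \<xi>\<^sub>\<psi>) \<xi>\<^sub>\<psi>"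
    using assms(6) by (auto simp: coupling_def vector_functional_def)
  have p: "p \<in> vn_tensor t M (commutant M)" "projection p"
    and diag: "\<And>x. x \<in> M \<Longrightarrow> p o\<^sub>L op_tensor t x id_blinfun o\<^sub>L p =
      p o\<^sub>L op_tensor t id_blinfun (J o\<^sub>L adj x o\<^sub>L J) o\<^sub>L p"
    using assms(7) by (auto simp: diagonal_projection_def)
  have bound: "cmod (\<phi> x - \<psi> x) \<le> 4 * sqrt (1 - Re (\<Phi> p))" if x: "x \<in> M" "norm x \<le> 1" for x
  proof -
    have x_BH: "x \<in> BH" using x(1) by (rule von_neumann_algebra_BH [OF M])
    \<comment> \<open>The mirror image of \<open>x\<close> in the commutant; the antilinearity of
      the adjoint cancels against the conjugations, so that \<open>y\<close> has the same
      expectation at \<open>\<xi>\<^sub>\<psi>\<close> as \<open>x\<close>.\<close>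
    define y where "y = J o\<^sub>L adj x o\<^sub>L J"
    have y: "y \<in> commutant M"
      unfolding y_def JMJ [symmetric] using von_neumann_algebra_adj [OF M x(1)] by (rule imageI)
    have norm_y: "norm y \<le> 1"
    proof (rule norm_blinfun_bound)
      show "norm (y v) \<le> 1 * norm v" for v
        using order_trans [OF norm_blinfun [of "adj x" "J v"]
            mult_right_mono [OF order_trans [OF norm_adj_le [OF x_BH] x(2)] norm_ge_zero]]
        by (simp add: y_def J(2))
    qed simp
    have J\<xi>: "J \<xi>\<^sub>\<psi> = \<xi>\<^sub>\<psi>" using J_fix \<xi>(1) by (rule bspec)
    have "cinner (y \<xi>\<^sub>\<psi>) \<xi>\<^sub>\<psi> = cinner (J (adj x \<xi>\<^sub>\<psi>)) (J \<xi>\<^sub>\<psi>)" by (simp add: y_def J\<xi>)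
    also have "\<dots> = cnj (cinner (adj x \<xi>\<^sub>\<psi>) \<xi>\<^sub>\<psi>)" by (rule antilinear_isometry_cinner [OF J])
    also have "\<dots> = \<psi> x"
      by (simp only: \<xi>(2) [OF x(1)] cinner_adj_right [OF x_BH] cinner_commute [symmetric])
    finally have \<psi>: "\<Phi> (op_tensor t id_blinfun y) = \<psi> x" by (simp add: \<Phi>_right [OF y])
    let ?X = "op_tensor t x id_blinfun" and ?Y = "op_tensor t id_blinfun y"
    have X: "?X \<in> vn_tensor t M (commutant M)" and Y: "?Y \<in> vn_tensor t M (commutant M)"
      by (intro op_tensor_in_vn_tensor [OF t M M'] von_neumann_algebra_id M M' x y)+
    have "norm (?X - ?Y) \<le> norm ?X + norm ?Y" by (rule norm_triangle_ineq4)
    also have "norm ?X \<le> norm x * norm (id_blinfun :: 'h op)"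
      by (rule norm_op_tensor_le [OF t x_BH BH_id])
    also have "\<dots> \<le> 1 * 1"
      by (intro mult_mono x norm_blinfun_id_le) simp_all
    also have "norm ?Y \<le> norm (id_blinfun :: 'h op) * norm y"
      by (rule norm_op_tensor_le [OF t BH_id von_neumann_algebra_BH [OF M' y]])
    also have "\<dots> \<le> 1 * 1"
      by (intro mult_mono norm_y norm_blinfun_id_le) simp_all
    finally have norm_XY: "norm (?X - ?Y) \<le> 2" by simp
    have "p o\<^sub>L (?X - ?Y) o\<^sub>L p = (p o\<^sub>L ?X o\<^sub>L p) - (p o\<^sub>L ?Y o\<^sub>L p)"
      by (intro blinfun_eqI) (simp add: blinfun.diff_left blinfun.diff_right)
    also have "\<dots> = 0" using diag [OF x(1)] by (simp add: y_def)
    \<comment> \<open>One factor \<open>2\<close> is the number of summands in the compression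
      estimate, the other is the bound \<open>norm_XY\<close>.\<close>
    finally have "cmod (\<Phi> (?X - ?Y)) \<le> 2 * 2 * sqrt (1 - Re (\<Phi> p))"
      by (intro normal_state_compression_zero [OF N \<Phi> p] von_neumann_algebra_minus [OF N] X Y norm_XY)
    moreover have "\<Phi> (?X - ?Y) = \<phi> x - \<psi> x"
      using \<Phi> by (simp add: state_minus [OF N _ X Y] normal_state_def \<Phi>_left x(1) \<psi>)
    ultimately show ?thesis by simp
  qed
  \<comment> \<open>A real supremum inherits an upper bound only over a nonempty index set.\<close>
  have "id_blinfun \<in> {x \<in> M. norm x \<le> 1}"
    by (simp add: von_neumann_algebra_id [OF M] norm_blinfun_id_le)
  then show ?thesis
    unfolding functional_norm_def by (intro cSUP_least bound) auto
qed

end
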